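(* For every integer $n>2$, the edge-monotone path $\mathfrak{P}_n$ on $n$ vertices satisfies \[\overline{R}_{lex}(\mathfrak{P}_n) \leq 2n-3+\sqrt{2n^2-8n+11}.\]
   Context: All graphs are finite and simple. An edge-ordered graph $(G,\prec)$ is a graph $G$ with a linear ordering $\prec$ of its edges. $(G,\prec_1)$ is an edge-ordered subgraph of $(H,\prec_2)$ if $G$ is a (not necessarily induced) subgraph of $H$ and $\prec_1$ is a suborder of $\prec_2$. Isomorphisms of edge-ordered graphs are graph isomorphisms preserving the edge-orderings; a copy of $\mathfrak{G}$ is an edge-ordered subgraph isomorphic to $\mathfrak{G}$, and it is monochromatic if all its edges have the same color. An ordering $\prec$ of the edges of a graph $G=(V,E)$ is lexicographic if there is a one-to-one correspondence $f\colon V\to\{1,\dots,|V|\}$ such that any two edges $\{u,v\}$ and $\{w,t\}$ of $G$ with $f(u)<f(v)$ and $f(w)<f(t)$ satisfy $\{u,v\}\prec\{w,t\}$ if either $f(u)<f(w)$, or $f(u)=f(w)$ and $f(v)<f(t)$. Up to isomorphism there is a unique lexicographic edge-ordering $\mathfrak{K}^{lex}_N$ of the complete graph $K_N$. The lexicographic edge-ordered Ramsey number $\overline{R}_{lex}(\mathfrak{G})$ of a lexicographically edge-ordered graph $\mathfrak{G}$ is the minimum $N$ such that every 2-coloring of the edges of $\mathfrak{K}^{lex}_N$ contains a monochromatic copy of $\mathfrak{G}$ as an edge-ordered subgraph. The edge-monotone path $\mathfrak{P}_n=(P_n,\prec)$ is the path on $n$ vertices $v_1,\dots,v_n$ with edges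 $\{v_i,v_{i+1}\}$, $1\le i\le n-1$, ordered by $\{v_1,v_2\}\prec\{v_2,v_3\}\prec\cdots\prec\{v_{n-1},v_n\}$ (this is a lexicographic edge-ordering). *)

theory Defs
  imports Complex_Main "HOL-Library.Extended_Real"
begin

record 'a eograph =
  verts :: "'a set"
  edges :: "'a set set"
  eless :: "'a set rel"

text \<open>\<open>eless G\<close> is the strict order \<open>\<prec>\<close>, as a set of pairs of edges of \<open>G\<close>.\<close>

definition edge_ordered_graph :: "'a eograph \<Rightarrow> bool" where
  "edge_ordered_graph G \<longleftrightarrow>
     finite (verts G) \<and>
     (\<forall>e\<in>edges G. e \<subseteq> verts G \<and> card e = 2) \<and>
     eless G \<subseteq> edges G \<times> edges G \<and>
     irrefl (eless G) \<and> trans (eless G) \<and> total_on (edges G) (eless G)"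

definition eo_subgraph :: "'a eograph \<Rightarrow> 'a eograph \<Rightarrow> bool" where
  "eo_subgraph G H \<longleftrightarrow>
     edge_ordered_graph G \<and> edge_ordered_graph H \<and>
     verts G \<subseteq> verts H \<and> edges G \<subseteq> edges H \<and> eless G \<subseteq> eless H"

definition eo_isomorphic :: "'a eograph \<Rightarrow> 'b eograph \<Rightarrow> bool" where
  "eo_isomorphic G H \<longleftrightarrow>
     (\<exists>f. bij_betw f (verts G) (verts H) \<and>
          (\<forall>u\<in>verts G. \<forall>v\<in>verts G. {u, v} \<in> edges G \<longleftrightarrow> {f u, f v} \<in> edges H) \<and>
          (\<forall>d\<in>edges G. \<forall>e\<in>edges G. (d, e) \<in> eless G \<longleftrightarrow> (f ` d, f ` e) \<in> eless H))"

definition lexicographic :: "'a eograph \<Rightarrow> bool" where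
  "lexicographic G \<longleftrightarrow>
     (\<exists>f. bij_betw f (verts G) {1..card (verts G)} \<and>
          (\<forall>u v w t. {u, v} \<in> edges G \<and> {w, t} \<in> edges G \<and> f u < f v \<and> f w < f t \<and>
             (f u < f w \<or> f u = f w \<and> f v < f t) \<longrightarrow> ({u, v}, {w, t}) \<in> eless G))"

definition Klex :: "nat \<Rightarrow> nat eograph" where
  "Klex N =
     \<lparr>verts = {1..N},
      edges = {e. e \<subseteq> {1..N} \<and> card e = 2},
      eless = {({u, v}, {w, t}) | u v w t.
                 {u, v, w, t} \<subseteq> {1..N} \<and> u < v \<and> w < t \<and> (u < w \<or> u = w \<and> v < t)}\<rparr>"

definition mono_path :: "nat \<Rightarrow> nat eograph" where
  "mono_path n =
     \<lparr>verts = {1..n},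
      edges = {{i, i + 1} | i. 1 \<le> i \<and> i < n},
      eless = {({i, i + 1}, {j, j + 1}) | i j. 1 \<le> i \<and> i < j \<and> j < n}\<rparr>"

definition has_mono_copy :: "('a set \<Rightarrow> bool) \<Rightarrow> 'b eograph \<Rightarrow> 'a eograph \<Rightarrow> bool" where
  "has_mono_copy col G K \<longleftrightarrow>
     (\<exists>H. eo_subgraph H K \<and> eo_isomorphic G H \<and> (\<exists>c. \<forall>e\<in>edges H. col e = c))"

text \<open>The minimum is taken in \<open>enat\<close>, so that it is \<open>\<infinity>\<close>, and not an arbitrary
  natural number, if no \<open>N\<close> has the Ramsey property. The colours are the two values
  of \<open>bool\<close>; values of \<open>col\<close> on sets that are not edges of \<open>Klex N\<close> play no role.\<close>

definition R_lex :: "'a eograph \<Rightarrow> enat" where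
  "R_lex G = Inf {enat N | N. \<forall>col. has_mono_copy col G (Klex N)}"

lemma card2_nat: "card (e :: nat set) = 2 \<longleftrightarrow> (\<exists>u v. u < v \<and> e = {u, v})"
proof
  assume "card e = 2"
  then obtain u v where "e = {u, v}" "u \<noteq> v"
    unfolding card_2_iff by blast
  then have "u < v \<and> e = {u, v} \<or> v < u \<and> e = {v, u}"
    by auto
  then show "\<exists>u v. u < v \<and> e = {u, v}"
    by blast
qed auto

lemma doubleton_less_eq:
  "(u :: nat) < v \<Longrightarrow> w < t \<Longrightarrow> {u, v} = {w, t} \<longleftrightarrow> u = w \<and> v = t"
  by (auto simp: doubleton_eq_iff)

lemma Klex_eless_iff:
  assumes "u < v" "w < t"
  shows "({u, v}, {w, t}) \<in> eless (Klex N) \<longleftrightarrow>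
         {u, v, w, t} \<subseteq> {1..N} \<and> (u < w \<or> u = w \<and> v < t)"
  using assms by (fastforce simp: Klex_def doubleton_less_eq)

lemma edge_ordered_graph_Klex: "edge_ordered_graph (Klex N)"
proof -
  have sub: "eless (Klex N) \<subseteq> edges (Klex N) \<times> edges (Klex N)"
    by (auto simp: Klex_def)
  have edge: "\<exists>u v. u < v \<and> e = {u, v} \<and> {u, v} \<subseteq> {1..N}" if "e \<in> edges (Klex N)" for e
  proof -
    have "card e = 2" "e \<subseteq> {1..N}"
      using that by (auto simp: Klex_def)
    then show ?thesis
      unfolding card2_nat by blast
  qed
  have "irrefl (eless (Klex N))"
  proof (rule irreflI)
    fix e show "(e, e) \<notin> eless (Klex N)"
      using edge[of e] sub Klex_eless_iff[of _ _ _ _ N] by blast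
  qed
  moreover have "trans (eless (Klex N))"
  proof (rule transI)
    fix a b c
    assume *: "(a, b) \<in> eless (Klex N)" "(b, c) \<in> eless (Klex N)"
    then have "a \<in> edges (Klex N)" "b \<in> edges (Klex N)" "c \<in> edges (Klex N)"
      using sub by auto
    from edge[OF this(1)] edge[OF this(2)] edge[OF this(3)]
    obtain u v w t x y where "u < v" "a = {u, v}" "w < t" "b = {w, t}" "x < y" "c = {x, y}"
      by blast
    with * show "(a, c) \<in> eless (Klex N)"
      by (auto simp: Klex_eless_iff)
  qed
  moreover have "total_on (edges (Klex N)) (eless (Klex N))"
  proof (rule total_onI)
    fix a b
    assume ab: "a \<in> edges (Klex N)" "b \<in> edges (Klex N)" and ne: "a \<noteq> b"
    from edge[OF ab(1)] edge[OF ab(2)]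
    obtain u v w t where "u < v" "a = {u, v}" "{u, v} \<subseteq> {1..N}"
      "w < t" "b = {w, t}" "{w, t} \<subseteq> {1..N}"
      by blast
    with ne show "(a, b) \<in> eless (Klex N) \<or> (b, a) \<in> eless (Klex N)"
      by (auto simp: Klex_eless_iff)
  qed
  ultimately show ?thesis
    using sub unfolding edge_ordered_graph_def by (auto simp: Klex_def)
qed

lemma lexicographic_Klex: "lexicographic (Klex N)"
  unfolding lexicographic_def
proof (intro exI[of _ id] conjI allI impI)
  show "bij_betw id (verts (Klex N)) {1..card (verts (Klex N))}"
    by (simp add: Klex_def)
  fix u v w t
  assume "{u, v} \<in> edges (Klex N) \<and> {w, t} \<in> edges (Klex N) \<and> id u < id v \<and> id w < id t \<and>
    (id u < id w \<or> id u = id w \<and> id v < id t)"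
  then show "({u, v}, {w, t}) \<in> eless (Klex N)"
    by (subst Klex_eless_iff) (auto simp: Klex_def)
qed

text \<open>Every lexicographically edge-ordered complete graph is isomorphic to some \<open>Klex N\<close>.\<close>

lemma Klex_unique:
  assumes G: "edge_ordered_graph G" "lexicographic G"
    and complete: "edges G = {e. e \<subseteq> verts G \<and> card e = 2}"
  shows "eo_isomorphic G (Klex (card (verts G)))"
proof -
  let ?N = "card (verts G)"
  obtain f where f: "bij_betw f (verts G) {1..?N}"
    and lex: "\<And>u v w t. \<lbrakk>{u, v} \<in> edges G; {w, t} \<in> edges G; f u < f v; f w < f t;
      f u < f w \<or> f u = f w \<and> f v < f t\<rbrakk> \<Longrightarrow> ({u, v}, {w, t}) \<in> eless G"
    using G(2) unfolding lexicographic_def by blast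
  have inj: "f u = f v \<longleftrightarrow> u = v" if "u \<in> verts G" "v \<in> verts G" for u v
    using f that unfolding bij_betw_def inj_on_def by blast
  have img: "f u \<in> {1..?N}" if "u \<in> verts G" for u
    using f that by (rule bij_betwE[THEN bspec])
  have edge: "\<exists>u v. e = {u, v} \<and> u \<in> verts G \<and> v \<in> verts G \<and> f u < f v" if "e \<in> edges G" for e
  proof -
    have "card e = 2" "e \<subseteq> verts G"
      using that complete by auto
    then obtain u v where uv: "e = {u, v}" "u \<noteq> v" "u \<in> verts G" "v \<in> verts G"
      unfolding card_2_iff by auto
    then have "f u \<noteq> f v"
      using inj[of u v] by simp
    then have "f u < f v \<and> e = {u, v} \<or> f v < f u \<and> e = {v, u}"
      using uv(1) by auto
    then show ?thesis
      using uv(3,4) by blast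
  qed
  have ord: "(d, e) \<in> eless G \<longleftrightarrow> (f ` d, f ` e) \<in> eless (Klex ?N)"
    if "d \<in> edges G" "e \<in> edges G" for d e
  proof -
    obtain u v where d: "d = {u, v}" "u \<in> verts G" "v \<in> verts G" "f u < f v"
      using edge[OF \<open>d \<in> edges G\<close>] by blast
    obtain w t where e: "e = {w, t}" "w \<in> verts G" "t \<in> verts G" "f w < f t"
      using edge[OF \<open>e \<in> edges G\<close>] by blast
    have K: "(f ` d, f ` e) \<in> eless (Klex ?N) \<longleftrightarrow> f u < f w \<or> f u = f w \<and> f v < f t"
      using d e img[of u] img[of v] img[of w] img[of t] by (simp add: Klex_eless_iff)
    have asym: "(e, d) \<notin> eless G" if "(d, e) \<in> eless G"
      using G(1) that unfolding edge_ordered_graph_def by (meson irrefl_def transD)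
    have irr: "(d, d) \<notin> eless G"
      using G(1) unfolding edge_ordered_graph_def by (simp add: irrefl_def)
    consider "f u < f w \<or> f u = f w \<and> f v < f t" | "f w < f u \<or> f w = f u \<and> f t < f v"
      | "f u = f w" "f v = f t"
      by linarith
    then show ?thesis
    proof cases
      case 1
      then have "(d, e) \<in> eless G"
        using lex[of u v w t] d(4) e(4) that unfolding d(1) e(1) by simp
      with 1 K show ?thesis by simp
    next
      case 2
      then have "(e, d) \<in> eless G"
        using lex[of w t u v] d(4) e(4) that unfolding d(1) e(1) by simp
      with asym have "(d, e) \<notin> eless G" by blast
      with 2 K show ?thesis by auto
    next
      case 3
      then have "d = e"
        using inj[of u w] inj[of v t] d e by simp
      with irr have "(d, e) \<notin> eless G" by simp
      with 3 K show ?thesis by simp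
    qed
  qed
  have "{u, v} \<in> edges G \<longleftrightarrow> {f u, f v} \<in> edges (Klex ?N)"
    if "u \<in> verts G" "v \<in> verts G" for u v
    using that img[of u] img[of v] inj[of u v] complete
    by (cases "u = v") (auto simp: Klex_def)
  then show ?thesis
    unfolding eo_isomorphic_def
  proof (intro exI[of _ f] conjI ballI)
    show "bij_betw f (verts G) (verts (Klex ?N))"
      using f by (simp add: Klex_def)
  qed (use ord in blast)+
qed

lemma mono_path_eless_iff:
  "({i, i + 1}, {j, j + 1}) \<in> eless (mono_path n) \<longleftrightarrow> 1 \<le> i \<and> i < j \<and> j < n"
proof -
  have "{a, a + 1} = {b, b + 1} \<longleftrightarrow> a = b" for a b :: nat
    by (auto simp: doubleton_eq_iff)
  then show ?thesis by (force simp: mono_path_def)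
qed

lemma edge_ordered_graph_mono_path: "edge_ordered_graph (mono_path n)"
proof -
  have sub: "eless (mono_path n) \<subseteq> edges (mono_path n) \<times> edges (mono_path n)"
    by (fastforce simp: mono_path_def)
  have edge: "\<exists>i. e = {i, i + 1} \<and> 1 \<le> i \<and> i < n" if "e \<in> edges (mono_path n)" for e
    using that by (auto simp: mono_path_def)
  have "irrefl (eless (mono_path n))"
  proof (rule irreflI)
    fix e show "(e, e) \<notin> eless (mono_path n)"
      using edge[of e] sub mono_path_eless_iff[of _ _ n] by blast
  qed
  moreover have "trans (eless (mono_path n))"
  proof (rule transI)
    fix a b c
    assume *: "(a, b) \<in> eless (mono_path n)" "(b, c) \<in> eless (mono_path n)"
    then have "a \<in> edges (mono_path n)" "b \<in> edges (mono_path n)" "c \<in> edges (mono_path n)"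
      using sub by auto
    from edge[OF this(1)] edge[OF this(2)] edge[OF this(3)]
    obtain i j k where "a = {i, i + 1}" "b = {j, j + 1}" "c = {k, k + 1}"
      by blast
    with * show "(a, c) \<in> eless (mono_path n)"
      unfolding \<open>a = _\<close> \<open>b = _\<close> \<open>c = _\<close> mono_path_eless_iff by linarith
  qed
  moreover have "total_on (edges (mono_path n)) (eless (mono_path n))"
  proof (rule total_onI)
    fix a b
    assume ab: "a \<in> edges (mono_path n)" "b \<in> edges (mono_path n)" and ne: "a \<noteq> b"
    from edge[OF ab(1)] edge[OF ab(2)]
    obtain i j where ij: "a = {i, i + 1}" "1 \<le> i" "i < n" "b = {j, j + 1}" "1 \<le> j" "j < n"
      by blast
    with ne have "i \<noteq> j" by auto
    with ij show "(a, b) \<in> eless (mono_path n) \<or> (b, a) \<in> eless (mono_path n)"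
      unfolding \<open>a = _\<close> \<open>b = _\<close> mono_path_eless_iff by linarith
  qed
  ultimately show ?thesis
    using sub unfolding edge_ordered_graph_def by (auto simp: mono_path_def)
qed

lemma lexicographic_mono_path: "lexicographic (mono_path n)"
  unfolding lexicographic_def
proof (intro exI[of _ id] conjI allI impI)
  show "bij_betw id (verts (mono_path n)) {1..card (verts (mono_path n))}"
    by (simp add: mono_path_def)
  fix u v w t
  assume *: "{u, v} \<in> edges (mono_path n) \<and> {w, t} \<in> edges (mono_path n) \<and> id u < id v \<and>
    id w < id t \<and> (id u < id w \<or> id u = id w \<and> id v < id t)"
  then have "v = u + 1" "t = w + 1" "1 \<le> u" "w < n"
    by (auto simp: mono_path_def doubleton_eq_iff)
  moreover from this * have "u < w"
    by auto
  ultimately show "({u, v}, {w, t}) \<in> eless (mono_path n)"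
    by (simp only: mono_path_eless_iff)
qed

end

theory Submission
  imports Defs
begin

text \<open>In the lexicographic order two edges \<open>{a, b}\<close>, \<open>{b, c}\<close> satisfy \<open>{a, b} \<prec> {b, c}\<close> iff
  \<open>a < c\<close>, so a copy of the edge-monotone path is a sequence of distinct vertices with
  \<open>v\<^sub>i < v\<^sub>i\<^sub>+\<^sub>2\<close>. Split the vertices into a lower half \<open>A\<close> and an upper half \<open>B\<close>; one colour
  has at least half of the \<open>A\<close>-\<open>B\<close> edges. View these edges as a 0-1 matrix and delete alternately
  the first entry of every row and the first entry of every column. If an entry survives \<open>n - 2\<close>
  rounds, tracing back the deleted entries in front of it gives the path, whose vertices are
  distinct since they alternate between \<open>A\<close> and \<open>B\<close>. Every round also empties a further row or
  column, so that \<open>p\<close> row rounds and \<open>q\<close> column rounds delete at most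
  \<open>p * card A + q * card B - p * q\<close> entries.\<close>

section \<open>Deleting first entries of rows and columns\<close>

text \<open>A deleted entry is the first of its row, so its row determines it, and a round costs at
  most one entry per row.\<close>

lemma card_le_card_non_first:
  fixes E :: "('a \<times> 'b::linorder) set"
  assumes "finite A" "finite E" "E \<subseteq> A \<times> B"
  shows "card E \<le> card A + card {(x, y) \<in> E. \<exists>y'<y. (x, y') \<in> E}"
proof -
  define S where "S = {(x, y) \<in> E. \<exists>y'<y. (x, y') \<in> E}"
  have "inj_on fst (E - S)"
    unfolding S_def inj_on_def by clarsimp (metis linorder_neqE)
  moreover have "fst ` (E - S) \<subseteq> A"
    using assms(3) by auto
  ultimately have "card (E - S) \<le> card A"
    using assms(1) card_inj_on_le by blast
  moreover have "card E = card (E - S) + card S"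
    using assms(2) card_Diff_subset[of S E] card_mono[of E S] finite_subset[of S E]
    by (fastforce simp: S_def)
  ultimately show ?thesis
    by (simp add: S_def)
qed

text \<open>Induction on the number \<open>k\<close> of rounds: after a row round the matrix is
  transposed, so that the next round is again a row round, with \<open>A\<close> and
  \<open>B\<close> exchanged. Even indices of \<open>v\<close> are columns, odd ones rows. The
  product of the two round counts stands on the right to avoid truncated subtraction.\<close>

lemma exists_alternating_path:
  fixes E :: "('a::linorder \<times> 'a) set"
  assumes "finite A" "finite B" "E \<subseteq> A \<times> B"
    and "k div 2 \<le> card A" "(k + 1) div 2 \<le> card B"
    and "(k + 1) div 2 * card A + k div 2 * card B < card E + (k + 1) div 2 * (k div 2)"
  shows "\<exists>v. (\<forall>i\<le>k. (if even i then (v (Suc i), v i) else (v i, v (Suc i))) \<in> E) \<and>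
    (\<forall>i<k. v i < v (i + 2))"
  using assms
proof (induction k arbitrary: A B E)
  case 0
  then have "E \<noteq> {}" by auto
  then obtain x y where "(x, y) \<in> E" by auto
  then show ?case
    by (intro exI[of _ "\<lambda>i. if i = 0 then y else x"]) auto
next
  case (Suc k)
  define p q where "p = Suc k div 2" and "q = k div 2"
  have p': "(Suc k + 1) div 2 = Suc q" and q': "Suc k div 2 = p"
    by (auto simp: p_def q_def)
  define S where "S = {(x, y) \<in> E. \<exists>y'<y. (x, y') \<in> E}"
  define T where "T = prod.swap ` S"
  \<comment> \<open>The column \<open>Min B\<close> holds only first entries of rows, so the row
    round empties it. Dropping it saves one entry in each of the \<open>p\<close> column rounds to
    come, whence the product term.\<close>
  define B' where "B' = B - {Min B}"
  have finE: "finite E"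
    using Suc.prems(1-3) finite_subset by blast
  have "B \<noteq> {}" using Suc.prems(5) p' by auto
  then have cB: "card B = Suc (card B')"
    unfolding B'_def using Suc.prems(2) by (intro card.remove) auto
  have "card E \<le> card A + card S"
    unfolding S_def using Suc.prems finE by (intro card_le_card_non_first) auto
  moreover have "card T = card S"
    unfolding T_def by (intro card_image) auto
  ultimately have cE: "card E \<le> card A + card T" by simp
  have "Min B < y" if "(x, y) \<in> S" for x y
  proof -
    from that obtain y' where "y' < y" "(x, y') \<in> E" by (auto simp: S_def)
    moreover from this have "y' \<in> B" using Suc.prems(3) by auto
    then have "Min B \<le> y'" using Suc.prems(2) by simp
    ultimately show ?thesis by simp
  qed
  then have "S \<subseteq> A \<times> B'"
    using Suc.prems(3) unfolding B'_def S_def by blast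
  then have T: "T \<subseteq> B' \<times> A"
    unfolding T_def by auto
  have "p * card B' + q * card A < card T + p * q"
    using Suc.prems(6) cE unfolding p' q' cB by (simp add: algebra_simps)
  then have "\<exists>w. (\<forall>i\<le>k. (if even i then (w (Suc i), w i) else (w i, w (Suc i))) \<in> T) \<and>
      (\<forall>i<k. w i < w (i + 2))"
    using Suc.prems(1,2,4,5) T unfolding p' q' cB
    by (intro Suc.IH[of B' A]) (simp_all add: B'_def flip: p_def q_def)
  then obtain w
    where w: "\<And>i. i \<le> k \<Longrightarrow> (if even i then (w (Suc i), w i) else (w i, w (Suc i))) \<in> T"
      and inc: "\<And>i. i < k \<Longrightarrow> w i < w (i + 2)"
    by blast
  \<comment> \<open>The path \<open>w\<close> starts in row \<open>w 0\<close> at a surviving entry.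
    An entry to its left in that row supplies the vertex \<open>y\<close> to put in front, and
    \<open>y < w 1\<close> is the new monotonicity condition.\<close>
  have "(w 0, w 1) \<in> S"
    using w[of 0] by (auto simp: T_def)
  then obtain y where y: "y < w 1" "(w 0, y) \<in> E"
    by (auto simp: S_def)
  define v where "v = case_nat y w"
  have "(if even i then (v (Suc i), v i) else (v i, v (Suc i))) \<in> E" if "i \<le> Suc k" for i
  proof (cases i)
    case 0
    then show ?thesis using y by (simp add: v_def)
  next
    case (Suc j)
    then show ?thesis using w[of j] that by (auto simp: v_def T_def S_def split: if_splits)
  qed
  moreover have "v i < v (i + 2)" if "i < Suc k" for i
    using that y inc by (cases i) (auto simp: v_def)
  ultimately show ?case by blast
qed

section \<open>Copies of the path in \<open>Klex N\<close>\<close>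

text \<open>If \<open>b < a\<close>, both edges have smaller vertex \<open>b\<close> and
  \<open>a < c\<close> decides. Otherwise \<open>a\<close> is the least of the three vertices and
  lies only in the first edge.\<close>

lemma Klex_consecutive:
  assumes "{a, b, c} \<subseteq> {1..N}" "a \<noteq> b" "b \<noteq> c" "a < c"
  shows "({a, b}, {b, c}) \<in> eless (Klex N)"
proof -
  consider "a < b" "b < c" | "b < a" | "c < b"
    using assms by linarith
  then show ?thesis
  proof cases
    case 1
    then show ?thesis using assms Klex_eless_iff[of a b b c N] by simp
  next
    case 2
    then show ?thesis using assms Klex_eless_iff[of b a b c N] by (simp add: insert_commute)
  next
    case 3
    then show ?thesis using assms Klex_eless_iff[of a b c b N] by (simp add: insert_commute)
  qed
qed

text \<open>Comparing consecutive edges is enough, since transitivity extends the comparison to all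
  pairs.\<close>

lemma has_mono_copy_mono_path:
  fixes K :: "'a eograph"
  assumes K: "edge_ordered_graph K"
    and inj: "inj_on f {1..n}" and f: "f ` {1..n} \<subseteq> verts K"
    and edge: "\<And>i. 1 \<le> i \<Longrightarrow> i < n \<Longrightarrow> {f i, f (i + 1)} \<in> edges K"
    and step: "\<And>i. 1 \<le> i \<Longrightarrow> i + 1 < n \<Longrightarrow> ({f i, f (i + 1)}, {f (i + 1), f (i + 2)}) \<in> eless K"
    and col: "\<And>i. 1 \<le> i \<Longrightarrow> i < n \<Longrightarrow> col {f i, f (i + 1)} = c"
  shows "has_mono_copy col (mono_path n) K"
proof -
  define F where "F i = {f i, f (i + 1)}" for i
  have irr: "irrefl (eless K)" and tr: "trans (eless K)"
    using K by (auto simp: edge_ordered_graph_def)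
  have less: "(F i, F j) \<in> eless K" if "1 \<le> i" "i < j" "j < n" for i j
    using that(2,3)
  proof (induction j)
    case (Suc j)
    have "(F j, F (Suc j)) \<in> eless K"
      using step[of j] Suc.prems that(1) by (simp add: F_def)
    moreover have "i = j \<or> (F i, F j) \<in> eless K"
      using Suc by (auto simp: less_Suc_eq)
    ultimately show ?case
      using transD[OF tr] by blast
  qed simp
  \<comment> \<open>An isomorphism must also reflect the order; irreflexivity and transitivity give
    this converse.\<close>
  have less_iff: "(F i, F j) \<in> eless K \<longleftrightarrow> i < j" if "i \<in> {1..<n}" "j \<in> {1..<n}" for i j
  proof
    assume ij: "(F i, F j) \<in> eless K"
    show "i < j"
    proof (rule ccontr)
      assume "\<not> i < j"
      then have "i = j \<or> (F j, F i) \<in> eless K"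
        using less[of j i] that by (cases i j rule: linorder_cases) auto
      then have "(F i, F i) \<in> eless K"
        using ij transD[OF tr] by blast
      with irr show False by (simp add: irrefl_def)
    qed
  qed (use less that in simp)
  have f_eq: "f i = f j \<longleftrightarrow> i = j" if "i \<in> {1..n}" "j \<in> {1..n}" for i j
    using inj that by (rule inj_on_eq_iff)
  define E where "E = F ` {1..<n}"
  define H where "H = \<lparr>verts = f ` {1..n}, edges = E, eless = eless K \<inter> E \<times> E\<rparr>"
  have EK: "E \<subseteq> edges K"
    using edge by (auto simp: E_def F_def)
  have "e \<subseteq> f ` {1..n} \<and> card e = 2" if "e \<in> E" for e
  proof
    show "e \<subseteq> f ` {1..n}" using that by (auto simp: E_def F_def)
    show "card e = 2" using that EK K by (auto simp: edge_ordered_graph_def)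
  qed
  moreover have "trans (eless K \<inter> E \<times> E)"
    using tr unfolding trans_def by blast
  moreover have "total_on E (eless K)"
    using K EK unfolding edge_ordered_graph_def total_on_def by blast
  then have "total_on E (eless K \<inter> E \<times> E)"
    unfolding total_on_def by blast
  ultimately have "edge_ordered_graph H"
    using irr by (simp add: edge_ordered_graph_def H_def irrefl_def)
  then have sub: "eo_subgraph H K"
    using K f EK by (auto simp: eo_subgraph_def H_def)
  have edges_path: "edges (mono_path n) = (\<lambda>i. {i, i + 1}) ` {1..<n}"
    by (auto simp: mono_path_def)
  have edge_iff: "{u, v} \<in> edges (mono_path n) \<longleftrightarrow> {f u, f v} \<in> E"
    if uv: "u \<in> {1..n}" "v \<in> {1..n}" for u v
  proof -
    have "{u, v} = {i, i + 1} \<longleftrightarrow> {f u, f v} = F i" if "i \<in> {1..<n}" for i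
      using that uv by (simp add: F_def doubleton_eq_iff f_eq)
    then show ?thesis
      unfolding edges_path E_def image_iff by blast
  qed
  have "eo_isomorphic (mono_path n) H"
    unfolding eo_isomorphic_def
  proof (intro exI[of _ f] conjI ballI)
    show "bij_betw f (verts (mono_path n)) (verts H)"
      using inj by (simp add: mono_path_def H_def bij_betw_def)
  next
    fix u v
    assume "u \<in> verts (mono_path n)" "v \<in> verts (mono_path n)"
    then show "{u, v} \<in> edges (mono_path n) \<longleftrightarrow> {f u, f v} \<in> edges H"
      using edge_iff by (simp add: mono_path_def H_def)
  next
    fix d e
    assume "d \<in> edges (mono_path n)" "e \<in> edges (mono_path n)"
    then obtain i j where ij: "i \<in> {1..<n}" "d = {i, i + 1}" "j \<in> {1..<n}" "e = {j, j + 1}"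
      unfolding edges_path by blast
    have "(d, e) \<in> eless (mono_path n) \<longleftrightarrow> i < j"
      unfolding ij mono_path_eless_iff using ij by auto
    moreover have "(f ` d, f ` e) \<in> eless H \<longleftrightarrow> (F i, F j) \<in> eless K"
      using ij by (auto simp: H_def E_def F_def)
    ultimately show "(d, e) \<in> eless (mono_path n) \<longleftrightarrow> (f ` d, f ` e) \<in> eless H"
      using less_iff ij by simp
  qed
  moreover have "\<forall>e\<in>edges H. col e = c"
    using col by (auto simp: H_def E_def F_def)
  ultimately show ?thesis
    using sub unfolding has_mono_copy_def by blast
qed

text \<open>The assumption \<open>large\<close> is the deletion count doubled, because the majority
  colour is only known to have half of the \<open>A\<close>-\<open>B\<close> edges.\<close>

lemma Klex_has_mono_copy:
  fixes n N :: nat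
  assumes n: "2 \<le> n"
    and size: "(n - 2) div 2 \<le> N div 2" "(n - 1) div 2 \<le> N - N div 2"
    and large: "2 * ((n - 1) div 2 * (N div 2) + (n - 2) div 2 * (N - N div 2))
      < N div 2 * (N - N div 2) + 2 * ((n - 1) div 2 * ((n - 2) div 2))"
  shows "has_mono_copy col (mono_path n) (Klex N)"
proof -
  define A B where "A = {1..N div 2}" and "B = {N div 2 + 1..N}"
  define C where "C c = {(x, y) \<in> A \<times> B. col {x, y} = c}" for c
  have cards: "card A = N div 2" "card B = N - N div 2" and fin: "finite A" "finite B"
    by (auto simp: A_def B_def)
  have "C True \<union> C False = A \<times> B" "C True \<inter> C False = {}"
    by (auto simp: C_def)
  moreover have "finite (C c)" for c
    using fin finite_subset[of "C c" "A \<times> B"] by (auto simp: C_def)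
  ultimately have "card (C True) + card (C False) = card A * card B"
    by (metis card_Un_disjoint card_cartesian_product)
  then have "\<exists>c. card A * card B \<le> 2 * card (C c)"
    by (cases "card (C True) \<le> card (C False)") (auto intro: exI[of _ True] exI[of _ False])
  then obtain c where c: "card A * card B \<le> 2 * card (C c)" by blast
  \<comment> \<open>After \<open>k\<close> rounds the path has the \<open>k + 2\<close> vertices
    \<open>v 0\<close>, ..., \<open>v (k + 1)\<close>.\<close>
  define k where "k = n - 2"
  have k: "(k + 1) div 2 = (n - 1) div 2" "k div 2 = (n - 2) div 2" "n = k + 2"
    using n by (simp_all add: k_def)
  have "\<exists>v. (\<forall>i\<le>k. (if even i then (v (Suc i), v i) else (v i, v (Suc i))) \<in> C c) \<and>
      (\<forall>i<k. v i < v (i + 2))"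
    using size large c unfolding k(1,2)
    by (intro exists_alternating_path[OF fin]) (auto simp: C_def k(1,2)[simplified] cards)
  then obtain v
    where v: "\<And>i. i \<le> k \<Longrightarrow> (if even i then (v (Suc i), v i) else (v i, v (Suc i))) \<in> C c"
      and inc: "\<And>i. i < k \<Longrightarrow> v i < v (i + 2)"
    by blast
  have side: "v i \<in> (if even i then B else A)" if "i \<le> k + 1" for i
  proof (cases i)
    case 0
    then show ?thesis using v[of 0] by (auto simp: C_def)
  next
    case (Suc j)
    then show ?thesis using v[of j] that by (auto simp: C_def split: if_splits)
  qed
  have less: "v i < v (i + 2 * Suc d)" if "i + 2 * Suc d \<le> k + 1" for i d
    using that
  proof (induction d)
    case 0
    then show ?case using inc[of i] by simp
  next
    case (Suc d)
    then have "v i < v (i + 2 * Suc d)" by simp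
    also have "\<dots> < v (i + 2 * Suc d + 2)" using inc[of "i + 2 * Suc d"] Suc.prems by simp
    finally show ?case by (simp add: algebra_simps)
  qed
  \<comment> \<open>Indices of equal parity are joined by increasing steps of two; indices of
    different parity lie in opposite halves.\<close>
  have neq: "v i \<noteq> v j" if ij: "i < j" "j \<le> k + 1" for i j
  proof (cases "even (j - i)")
    case True
    then obtain d where "j - i = 2 * Suc d"
      using ij by (metis dvdE gr0_implies_Suc mult_0_right zero_less_diff neq0_conv less_irrefl)
    then have "j = i + 2 * Suc d" using ij by simp
    then show ?thesis using less[of i d] ij by simp
  next
    case False
    then have "even i \<longleftrightarrow> odd j" using ij by auto
    then show ?thesis using side[of i] side[of j] ij by (auto simp: A_def B_def split: if_splits)
  qed
  have range: "v i \<in> {1..N}" if "i \<le> k + 1" for i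
    using side[OF that] by (auto simp: A_def B_def split: if_splits)
  show ?thesis
  \<comment> \<open>The vertices of \<open>mono_path\<close> are numbered from 1, those of
    \<open>v\<close> from 0.\<close>
  proof (rule has_mono_copy_mono_path[where f = "\<lambda>i. v (i - 1)" and c = c])
    show "edge_ordered_graph (Klex N)" by (rule edge_ordered_graph_Klex)
    show "inj_on (\<lambda>i. v (i - 1)) {1..n}"
    proof (rule linorder_inj_onI)
      fix i j assume "i < j" "i \<in> {1..n}" "j \<in> {1..n}"
      then show "v (i - 1) \<noteq> v (j - 1)" using neq[of "i - 1" "j - 1"] k(3) by auto
    qed auto
    show "(\<lambda>i. v (i - 1)) ` {1..n} \<subseteq> verts (Klex N)"
      using range k(3) by (auto simp: Klex_def)
  next
    fix i assume i: "1 \<le> i" "i < n"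
    then have i': "i - 1 < i" "i \<le> k + 1" using k(3) by auto
    show "{v (i - 1), v (i + 1 - 1)} \<in> edges (Klex N)"
      using neq[OF i'] range[of "i - 1"] range[of i] i' by (simp add: Klex_def)
    show "col {v (i - 1), v (i + 1 - 1)} = c"
      using v[of "i - 1"] i i' by (auto simp: C_def insert_commute split: if_splits)
  next
    fix i assume i: "1 \<le> i" "i + 1 < n"
    then have "{v (i - 1), v i, v (i + 1)} \<subseteq> {1..N}" "v (i - 1) \<noteq> v i" "v i \<noteq> v (i + 1)"
      "v (i - 1) < v (i + 1)"
      using k(3) range[of "i - 1"] range[of i] range[of "i + 1"] neq[of "i - 1" i]
        neq[of i "i + 1"] inc[of "i - 1"] by auto
    then show "({v (i - 1), v (i + 1 - 1)}, {v (i + 1 - 1), v (i + 2 - 1)}) \<in> eless (Klex N)"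
      using Klex_consecutive by simp
  qed
qed

section \<open>From the deletion count to the square root\<close>

text \<open>Fixing both parities removes the divisions. If \<open>X\<close> is the right side minus
  the left side of the conclusion, the hypothesis then expands to \<open>4 * X > c\<close> with a
  constant \<open>c\<close> between 1 and 4.\<close>

lemma large_of_square_less:
  fixes n N :: nat
  assumes n: "2 \<le> n"
    and N: "2 * (int n)\<^sup>2 - 8 * int n + 11 < (int N + 4 - 2 * int n)\<^sup>2"
  shows "2 * ((n - 1) div 2 * (N div 2) + (n - 2) div 2 * (N - N div 2))
      < N div 2 * (N - N div 2) + 2 * ((n - 1) div 2 * ((n - 2) div 2))"
proof -
  define m h where "m = (n - 2) div 2" and "h = N div 2"
  have int_less: "a < b" if "int a < int b" for a b using that by simp
  have "n = 2 * m + 2 \<or> n = 2 * m + 3" using n by (auto simp: m_def)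
  moreover have "N = 2 * h \<or> N = 2 * h + 1" by (auto simp: h_def)
  ultimately consider "n = 2 * m + 2" "N = 2 * h" | "n = 2 * m + 2" "N = 2 * h + 1"
    | "n = 2 * m + 3" "N = 2 * h" | "n = 2 * m + 3" "N = 2 * h + 1" by blast
  then show ?thesis
  proof cases
    case 1
    then have "(n - 1) div 2 = m" "(n - 2) div 2 = m" "N div 2 = h" "N - N div 2 = h" by auto
    then show ?thesis using N unfolding 1
      by (intro int_less) (simp add: power2_eq_square algebra_simps)
  next
    case 2
    then have "(n - 1) div 2 = m" "(n - 2) div 2 = m" "N div 2 = h" "N - N div 2 = h + 1" by auto
    then show ?thesis using N unfolding 2
      by (intro int_less) (simp add: power2_eq_square algebra_simps)
  next
    case 3
    then have "(n - 1) div 2 = m + 1" "(n - 2) div 2 = m" "N div 2 = h" "N - N div 2 = h" by auto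
    then show ?thesis using N unfolding 3
      by (intro int_less) (simp add: power2_eq_square algebra_simps)
  next
    case 4
    then have "(n - 1) div 2 = m + 1" "(n - 2) div 2 = m" "N div 2 = h" "N - N div 2 = h + 1"
      by auto
    then show ?thesis using N unfolding 4
      by (intro int_less) (simp add: power2_eq_square algebra_simps)
  qed
qed

theorem proposition5:
  fixes n :: nat
  assumes "n > 2"
  shows "ereal_of_enat (R_lex (mono_path n))
           \<le> ereal (2 * real n - 3 + sqrt (2 * (real n)\<^sup>2 - 8 * real n + 11))"
proof -
  define D where "D = 2 * (real n)\<^sup>2 - 8 * real n + 11"
  have D: "D = 2 * (real n - 2)\<^sup>2 + 3"
    by (simp add: D_def power2_eq_square algebra_simps)
  then have "0 \<le> D" by simp
  define x where "x = 2 * real n - 3 + sqrt D"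
  have x: "2 * real n - 3 \<le> x" using \<open>0 \<le> D\<close> by (simp add: x_def)
  \<comment> \<open>It suffices that the floor of the claimed bound has the Ramsey property.\<close>
  define N where "N = nat \<lfloor>x\<rfloor>"
  have Nx: "real N \<le> x" "x < real N + 1"
    using x assms by (auto simp: N_def)
  then have "2 * real n - 3 < real N + 1" using x by simp
  \<comment> \<open>This yields both size conditions on the halves.\<close>
  then have "2 * n < N + 4" by linarith
  \<comment> \<open>This is \<open>x < real N + 1\<close> rearranged; both sides are nonnegative, so
    it may be squared.\<close>
  have "sqrt D < real N + 4 - 2 * real n" using Nx by (simp add: x_def)
  then have "D < (real N + 4 - 2 * real n)\<^sup>2"
    using \<open>0 \<le> D\<close> power_strict_mono[of "sqrt D" _ 2] by simp
  then have "real_of_int (2 * (int n)\<^sup>2 - 8 * int n + 11)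
      < real_of_int ((int N + 4 - 2 * int n)\<^sup>2)"
    by (simp add: D_def)
  then have "2 * (int n)\<^sup>2 - 8 * int n + 11 < (int N + 4 - 2 * int n)\<^sup>2"
    by (simp only: of_int_less_iff)
  then have "has_mono_copy col (mono_path n) (Klex N)" for col
    using assms \<open>2 * n < N + 4\<close> by (intro Klex_has_mono_copy large_of_square_less) auto
  then have "R_lex (mono_path n) \<le> enat N"
    unfolding R_lex_def by (intro Inf_lower) blast
  then have "ereal_of_enat (R_lex (mono_path n)) \<le> ereal_of_enat (enat N)"
    by (simp only: ereal_of_enat_le_iff)
  also have "\<dots> \<le> ereal x" using Nx by simp
  finally show ?thesis by (simp add: x_def D_def)
qed

end
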